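(* Let $f\in C(I\times\mathbb{R}^n\times\mathbb{R}^n,\mathbb{R}^n)$ and let $k(t,\sigma,u)\in\mathbb{R}^n$ be continuous for $a\le\sigma\le t<\infty$, $u\in\mathbb{R}^n$. Suppose that $$|f(t,u,v)-f(t,\bar u,\bar v)|\le N\big(|u-\bar u|+|v-\bar v|\big)\quad (t\in I,\ u,v,\bar u,\bar v\in\mathbb{R}^n),$$ $$|k(t,\sigma,u)-k(t,\sigma,v)|\le r(t,\sigma)|u-v|\quad ((t,\sigma)\in D,\ u,v\in\mathbb{R}^n),$$ where $0\le N<1$ is a constant and $r\in C(D,\mathbb{R}_+)$, $D=\{(t,\sigma)\in I^2:a\le\sigma\le t<\infty\}$. Let $x\in C(I,\mathbb{R}^n)$ be a solution of $$x(t)=f\left(t,x(t),\frac{1}{\Gamma(\alpha)}\int_a^t N_\psi^\alpha(t,\sigma)k(t,\sigma,x(\sigma))\,d\sigma\right),\qquad t\in I.$$ Then $x$ depends continuously on the functions involved in the right-hand side of this equation, in the following sense. For every $T>a$ and every $\eta>0$ there is $\epsilon_1>0$ such that the following holds: whenever $\bar f\in C(I\times\mathbb{R}^n\times\mathbb{R}^n,\mathbb{R}^n)$, $\bar k(t,\sigma,u)\in\mathbb{R}^n$ is continuous for $a\le\sigma\le t<\infty$, $u\in\mathbb{R}^n$, and $y\in C(I,\mathbb{R}^n)$ is a solution of $$y(t)=\bar f\left(t,y(t),\frac{1}{\Gamma(\alpha)}\int_a^t N_\psi^\alpha(t,\sigma)\bar k(t,\sigma,y(\sigma))\,d\sigma\right),\qquad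 t\in I,$$ such that for all $t\in I$ $$\left|f\left(t,y(t),\frac{1}{\Gamma(\alpha)}\int_a^t N_\psi^\alpha(t,\sigma)k(t,\sigma,y(\sigma))\,d\sigma\right)-\bar f\left(t,y(t),\frac{1}{\Gamma(\alpha)}\int_a^t N_\psi^\alpha(t,\sigma)\bar k(t,\sigma,y(\sigma))\,d\sigma\right)\right|\le\epsilon_1,$$ one has $\sup_{t\in[a,T]}|x(t)-y(t)|\le\eta$.
   Context: Let $a\in\mathbb{R}$, $I=[a,\infty)$, $0<\alpha\le 1$, $\mathbb{R}_+=[0,\infty)$, and let $|\cdot|$ be a norm on $\mathbb{R}^n$. The function $\psi:I\to\mathbb{R}$ is increasing, positive on $(a,\infty)$, with continuous derivative $\psi'$ on $I$ and $\psi'(t)\ne 0$ for all $t$. Put $N_\psi^\alpha(t,s)=\psi'(s)(\psi(t)-\psi(s))^{\alpha-1}$ (not to be confused with the constant $N$). *)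

theory Defs
  imports "HOL-Analysis.Analysis"
begin

text \<open>
  The type class norm on \<^typ>\<open>real ^ 'n\<close> is the Euclidean one. An arbitrary norm is
  therefore a function satisfying the norm axioms; continuity and integrals of
  vector-valued functions refer to the standard topology of \<^typ>\<open>real ^ 'n\<close>, which every
  norm induces.
\<close>

definition is_norm :: "('a::real_vector \<Rightarrow> real) \<Rightarrow> bool" where
  "is_norm p \<longleftrightarrow>
     (\<forall>u. p u \<ge> 0) \<and>
     (\<forall>u. p u = 0 \<longleftrightarrow> u = 0) \<and>
     (\<forall>c u. p (c *\<^sub>R u) = \<bar>c\<bar> * p u) \<and>
     (\<forall>u v. p (u + v) \<le> p u + p v)"

definition tri_domain :: "real \<Rightarrow> (real \<times> real) set" where
  "tri_domain a = {(t, \<sigma>). a \<le> \<sigma> \<and> \<sigma> \<le> t}"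

text \<open>
  Here \<open>\<psi>'\<close> is the derivative of \<open>\<psi>\<close>. At \<open>s = t\<close> the value is \<open>0\<close>, because
  \<open>0 powr b = 0\<close> for every \<open>b\<close>; this affects a single point of the integrals below.
\<close>

definition psi_kernel ::
    "(real \<Rightarrow> real) \<Rightarrow> (real \<Rightarrow> real) \<Rightarrow> real \<Rightarrow> real \<Rightarrow> real \<Rightarrow> real" where
  "psi_kernel \<psi> \<psi>' \<alpha> t s = \<psi>' s * (\<psi> t - \<psi> s) powr (\<alpha> - 1)"

text \<open>
  For \<open>\<alpha> < 1\<close> the integrand is unbounded near \<open>\<sigma> = t\<close>. The Henstock-Kurzweil integral
  includes such improper integrals, and for continuous \<open>k\<close> and \<open>z\<close> the integrand
  is absolutely integrable.
\<close>

definition frac_integral ::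
    "real \<Rightarrow> (real \<Rightarrow> real) \<Rightarrow> (real \<Rightarrow> real) \<Rightarrow> real \<Rightarrow>
     (real \<Rightarrow> real \<Rightarrow> real ^ 'n \<Rightarrow> real ^ 'n) \<Rightarrow> (real \<Rightarrow> real ^ 'n) \<Rightarrow> real \<Rightarrow> real ^ 'n" where
  "frac_integral a \<psi> \<psi>' \<alpha> k z t =
     (1 / Gamma \<alpha>) *\<^sub>R integral {a..t} (\<lambda>\<sigma>. psi_kernel \<psi> \<psi>' \<alpha> t \<sigma> *\<^sub>R k t \<sigma> (z \<sigma>))"

definition continuous_rhs ::
    "real \<Rightarrow> (real \<Rightarrow> real ^ 'n \<Rightarrow> real ^ 'n \<Rightarrow> real ^ 'n) \<Rightarrow> bool" where
  "continuous_rhs a f \<longleftrightarrow> continuous_on ({a..} \<times> UNIV \<times> UNIV) (\<lambda>(t, u, v). f t u v)"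

definition continuous_kernel ::
    "real \<Rightarrow> (real \<Rightarrow> real \<Rightarrow> real ^ 'n \<Rightarrow> real ^ 'n) \<Rightarrow> bool" where
  "continuous_kernel a k \<longleftrightarrow>
     continuous_on {(t, \<sigma>, u). (t, \<sigma>) \<in> tri_domain a} (\<lambda>(t, \<sigma>, u). k t \<sigma> u)"

definition is_solution ::
    "real \<Rightarrow> (real \<Rightarrow> real) \<Rightarrow> (real \<Rightarrow> real) \<Rightarrow> real \<Rightarrow>
     (real \<Rightarrow> real ^ 'n \<Rightarrow> real ^ 'n \<Rightarrow> real ^ 'n) \<Rightarrow>
     (real \<Rightarrow> real \<Rightarrow> real ^ 'n \<Rightarrow> real ^ 'n) \<Rightarrow> (real \<Rightarrow> real ^ 'n) \<Rightarrow> bool" where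
  "is_solution a \<psi> \<psi>' \<alpha> f k z \<longleftrightarrow>
     continuous_on {a..} z \<and>
     (\<forall>t\<in>{a..}. z t = f t (z t) (frac_integral a \<psi> \<psi>' \<alpha> k z t))"

end

theory Submission imports Defs begin

text \<open>
  The difference of the two solutions is estimated in a Bielecki norm with weight
  \<open>E t = exp (l * (\<psi> t - \<psi> a))\<close>. The inequality \<open>exp (- u) * u powr (\<alpha> / 2) \<le> 1\<close> gives
  \<open>s powr (\<alpha> - 1) * exp (- l * s) \<le> l powr (- \<alpha> / 2) * s powr (\<alpha> / 2 - 1)\<close>. So the weighted kernel of order
  \<open>\<alpha>\<close> is dominated by a small multiple of the kernel of order \<open>\<alpha> / 2\<close>, whose integral is
  explicit. For large \<open>l\<close> the integral term becomes a contraction with factor at most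
  \<open>(1 - N) / 2\<close>, and no singular Gronwall inequality is needed.
\<close>

section \<open>Arbitrary norms: continuity and the bound for integrals\<close>

text \<open>Homogeneity and the triangle inequality make a norm convex, and a finite convex function
  on all of a finite-dimensional space is continuous.\<close>

lemma is_norm_continuous_on:
  fixes p :: "'a::euclidean_space \<Rightarrow> real"
  assumes "is_norm p"
  shows "continuous_on S p"
proof -
  have "convex_on UNIV p"
    unfolding convex_on_def
  proof (intro conjI allI impI ballI)
    fix x y :: 'a and u v :: real
    assume uv: "0 \<le> u" "0 \<le> v"
    have "p (u *\<^sub>R x + v *\<^sub>R y) \<le> p (u *\<^sub>R x) + p (v *\<^sub>R y)"
      using assms unfolding is_norm_def by blast
    also have "\<dots> = \<bar>u\<bar> * p x + \<bar>v\<bar> * p y"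
      using assms by (simp only: is_norm_def)
    also have "\<dots> = u * p x + v * p y"
      using uv by simp
    finally show "p (u *\<^sub>R x + v *\<^sub>R y) \<le> u * p x + v * p y" .
  qed auto
  then show ?thesis
    using convex_on_continuous[OF open_UNIV] continuous_on_subset by blast
qed

lemma is_norm_sum_le:
  assumes "is_norm p"
  shows "p (\<Sum>i\<in>A. g i) \<le> (\<Sum>i\<in>A. p (g i))"
proof -
  have p0: "p 0 = 0"
    using assms by (simp only: is_norm_def)
  show ?thesis
  proof (induction A rule: infinite_finite_induct)
  case (insert i A)
  have "p (g i + sum g A) \<le> p (g i) + p (sum g A)"
    using assms by (auto simp: is_norm_def)
  with insert show ?case by simp
qed (simp_all add: p0)
qed

text \<open>The inequality holds for Riemann sums, which have nonnegative weights, and survives the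
  limit because \<open>p\<close> is continuous. With a majorant \<open>G\<close>, integrability of
  \<open>p (F s)\<close> never has to be shown.\<close>

lemma is_norm_integral_le:
  fixes p :: "'b::euclidean_space \<Rightarrow> real" and F :: "'a::euclidean_space \<Rightarrow> 'b"
  assumes p: "is_norm p"
    and F: "(F has_integral I) (cbox a b)"
    and G: "(G has_integral J) (cbox a b)"
    and le: "\<And>s. s \<in> cbox a b \<Longrightarrow> p (F s) \<le> G s"
  shows "p I \<le> J"
proof (rule tendsto_le[OF division_filter_not_empty[of a b]])
  show "((\<lambda>D. \<Sum>(s, K)\<in>D. measure lborel K *\<^sub>R G s) \<longlongrightarrow> J) (division_filter (cbox a b))"
    using G has_integral_cbox by blast
  show "((\<lambda>D. p (\<Sum>(s, K)\<in>D. measure lborel K *\<^sub>R F s)) \<longlongrightarrow> p I) (division_filter (cbox a b))"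
    by (rule continuous_on_tendsto_compose[OF is_norm_continuous_on[OF p, of UNIV]])
      (use F[unfolded has_integral_cbox] in simp_all)
  show "\<forall>\<^sub>F D in division_filter (cbox a b).
      p (\<Sum>(s, K)\<in>D. measure lborel K *\<^sub>R F s) \<le> (\<Sum>(s, K)\<in>D. measure lborel K *\<^sub>R G s)"
  proof (rule eventually_mono[OF eventually_division_filter_tagged_division])
    fix D assume D: "D tagged_division_of cbox a b"
    have "p (\<Sum>(s, K)\<in>D. measure lborel K *\<^sub>R F s) \<le> (\<Sum>d\<in>D. p (case d of (s, K) \<Rightarrow> measure lborel K *\<^sub>R F s))"
      by (rule is_norm_sum_le[OF p])
    also have "\<dots> \<le> (\<Sum>(s, K)\<in>D. measure lborel K *\<^sub>R G s)"
    proof (rule sum_mono, clarify)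
      fix s K assume "(s, K) \<in> D"
      then have "s \<in> cbox a b"
        using tag_in_interval[OF D] by blast
      then have "measure lborel K * p (F s) \<le> measure lborel K * G s"
        using le by (intro mult_left_mono) auto
      moreover have "p (measure lborel K *\<^sub>R F s) = \<bar>measure lborel K\<bar> * p (F s)"
        using p by (simp only: is_norm_def)
      ultimately show "p (measure lborel K *\<^sub>R F s) \<le> measure lborel K *\<^sub>R G s"
        by simp
    qed
    finally show "p (\<Sum>(s, K)\<in>D. measure lborel K *\<^sub>R F s) \<le> (\<Sum>(s, K)\<in>D. measure lborel K *\<^sub>R G s)" .
  qed
qed

section \<open>Monotonicity of \<open>\<psi>\<close> and integrability of the kernel\<close>

lemma mono_on_derivative_nonneg:
  fixes f :: "real \<Rightarrow> real"
  assumes "mono_on {a..} f" and "a \<le> t"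
    and "(f has_real_derivative d) (at t within {a..})"
  shows "0 \<le> d"
proof (rule tendsto_lowerbound)
  show "((\<lambda>s. (f s - f t) / (s - t)) \<longlongrightarrow> d) (at t within {a..})"
    using assms(3) by (simp add: has_field_derivative_iff)
  show "\<forall>\<^sub>F s in at t within {a..}. 0 \<le> (f s - f t) / (s - t)"
    unfolding eventually_at_filter
  proof (intro always_eventually allI impI)
    fix s assume "s \<noteq> t" "s \<in> {a..}"
    then show "0 \<le> (f s - f t) / (s - t)"
      using assms(1,2) mono_onD[OF assms(1), of s t] mono_onD[OF assms(1), of t s]
      by (cases "s < t") (auto simp: divide_nonpos_neg)
  qed
  \<comment> \<open>Approaching \<open>t\<close> from the right stays inside \<open>{a..}\<close>,
    so the endpoint \<open>t = a\<close> is covered as well.\<close>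
  have "t islimpt {t<..<t+1}"
    by (simp add: islimpt_greaterThanLessThan1)
  then have "t islimpt {a..}"
    by (rule islimpt_subset) (use assms(2) in auto)
  then show "at t within {a..} \<noteq> bot"
    by (simp add: trivial_limit_within)
qed

text \<open>Strictness keeps the base \<open>\<psi> t - \<psi> s\<close> positive for
  \<open>s < t\<close>, so the antiderivative of the kernel can be differentiated there.\<close>

lemma psi_strict_mono:
  fixes \<psi> :: "real \<Rightarrow> real"
  assumes der: "\<And>t. t \<ge> a \<Longrightarrow> (\<psi> has_real_derivative \<psi>' t) (at t within {a..})"
    and pos: "\<And>t. t \<ge> a \<Longrightarrow> \<psi>' t > 0"
    and st: "a \<le> s" "s < t"
  shows "\<psi> s < \<psi> t"
proof (rule DERIV_pos_imp_increasing_open[OF st(2)])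
  show "\<exists>y. (\<psi> has_real_derivative y) (at u) \<and> 0 < y" if "s < u" "u < t" for u
  proof -
    have "u \<in> interior {a..}" using that st by simp
    then have "(\<psi> has_real_derivative \<psi>' u) (at u)"
      using der[of u] that st at_within_interior by (metis less_eq_real_def order_trans)
    then show ?thesis using pos[of u] that st by auto
  qed
  have "continuous_on {a..} \<psi>"
    using der by (metis DERIV_continuous atLeast_iff continuous_on_eq_continuous_within)
  then show "continuous_on {s..t} \<psi>"
    by (rule continuous_on_subset) (use st in auto)
qed

text \<open>The antiderivative \<open>H\<close> is continuous up to \<open>s = t\<close> because
  \<open>\<beta>\<close> is positive, and is differentiable in the open interval. The fundamental
  theorem in its interior form therefore tolerates the singularity at \<open>t\<close>.\<close>

lemma psi_kernel_has_integral:
  fixes \<psi> :: "real \<Rightarrow> real"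
  assumes der: "\<And>t. t \<ge> a \<Longrightarrow> (\<psi> has_real_derivative \<psi>' t) (at t within {a..})"
    and pos: "\<And>t. t \<ge> a \<Longrightarrow> \<psi>' t > 0"
    and \<beta>: "\<beta> > 0" and t: "a \<le> t"
  shows "(psi_kernel \<psi> \<psi>' \<beta> t has_integral (\<psi> t - \<psi> a) powr \<beta> / \<beta>) {a..t}"
proof -
  define H where "H s = - ((\<psi> t - \<psi> s) powr \<beta> / \<beta>)" for s
  have le: "\<psi> s \<le> \<psi> t" if "s \<in> {a..t}" for s
    using psi_strict_mono[OF der pos, of s t] that by (cases "s = t") auto
  have cont\<psi>: "continuous_on {a..} \<psi>"
    using der by (metis DERIV_continuous atLeast_iff continuous_on_eq_continuous_within)
  have "(psi_kernel \<psi> \<psi>' \<beta> t has_integral (H t - H a)) {a..t}"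
  proof (rule fundamental_theorem_of_calculus_interior[OF t])
    have "continuous_on {a..t} \<psi>"
      by (rule continuous_on_subset[OF cont\<psi>]) auto
    then show "continuous_on {a..t} H"
      unfolding H_def using le \<beta> by (intro continuous_intros continuous_on_powr') auto
    fix s assume s: "s \<in> {a<..<t}"
    then have "(\<psi> has_real_derivative \<psi>' s) (at s)"
      using der[of s] at_within_interior[of s "{a..}"] by simp
    moreover have "\<psi> s < \<psi> t"
      using psi_strict_mono[OF der pos, of s t] s by auto
    ultimately have "(H has_real_derivative psi_kernel \<psi> \<psi>' \<beta> t s) (at s)"
      unfolding H_def psi_kernel_def using \<beta>
      by (auto intro!: derivative_eq_intros simp: powr_diff field_simps)
    then show "(H has_vector_derivative psi_kernel \<psi> \<psi>' \<beta> t s) (at s)"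
      by (simp add: has_real_derivative_iff_has_vector_derivative)
  qed
  then show ?thesis using \<beta> by (simp add: H_def)
qed

lemma psi_kernel_nonneg:
  assumes "\<psi>' s > (0::real)"
  shows "psi_kernel \<psi> \<psi>' \<beta> t s \<ge> 0"
  using assms by (simp add: psi_kernel_def)

text \<open>A nonnegative integrable kernel is absolutely integrable, and multiplying by a function
  continuous on a compact interval, hence bounded and measurable, preserves this.\<close>

lemma psi_kernel_integrable_scaleR:
  fixes \<psi> :: "real \<Rightarrow> real" and g :: "real \<Rightarrow> 'a::euclidean_space"
  assumes der: "\<And>t. t \<ge> a \<Longrightarrow> (\<psi> has_real_derivative \<psi>' t) (at t within {a..})"
    and pos: "\<And>t. t \<ge> a \<Longrightarrow> \<psi>' t > 0"
    and \<beta>: "\<beta> > 0" and t: "a \<le> t" and g: "continuous_on {a..t} g"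
  shows "(\<lambda>s. psi_kernel \<psi> \<psi>' \<beta> t s *\<^sub>R g s) integrable_on {a..t}"
proof -
  have "psi_kernel \<psi> \<psi>' \<beta> t integrable_on {a..t}"
    using psi_kernel_has_integral[OF der pos \<beta> t] by blast
  then have K: "psi_kernel \<psi> \<psi>' \<beta> t absolutely_integrable_on {a..t}"
    using psi_kernel_nonneg pos by (intro nonnegative_absolutely_integrable_1) auto
  have "bilinear (\<lambda>(v :: 'a) (c :: real). c *\<^sub>R v)"
    unfolding bilinear_def by (auto intro!: linearI simp: algebra_simps)
  then have "(\<lambda>s. psi_kernel \<psi> \<psi>' \<beta> t s *\<^sub>R g s) absolutely_integrable_on {a..t}"
    by (rule absolutely_integrable_bounded_measurable_product[OF _ _ _ _ K])
      (use g in \<open>auto intro: compact_imp_bounded compact_continuous_image continuous_imp_measurable_on_sets_lebesgue\<close>)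
  then show ?thesis
    using absolutely_integrable_on_def by blast
qed

section \<open>The exponential weight and the weighted estimate\<close>

lemma exp_minus_mult_powr_le_1:
  fixes u b :: real
  assumes "0 \<le> u" "0 \<le> b" "b \<le> 1"
  shows "exp (- u) * u powr b \<le> 1"
proof -
  have "u powr b \<le> exp u"
  proof (cases "u \<le> 1")
    case True
    then have "u powr b \<le> 1" using assms by (simp add: powr_le1)
    then show ?thesis using assms(1) by (meson one_le_exp_iff order_trans)
  next
    case False
    then have "u powr b \<le> u" using assms powr_mono[of b 1 u] by simp
    then show ?thesis using exp_ge_add_one_self[of u] by linarith
  qed
  then show ?thesis by (simp add: exp_minus field_simps)
qed

text \<open>The weight is moved from \<open>s\<close> to \<open>t\<close>, which leaves the factor
  \<open>exp (- (l * d))\<close>. Half of the order pays for the decay in \<open>l\<close>; the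
  remaining order \<open>\<alpha> / 2\<close> is still positive, so the majorant is
  integrable.\<close>

lemma psi_kernel_exp_weight_le:
  fixes \<psi> :: "real \<Rightarrow> real"
  assumes "0 < \<alpha>" "\<alpha> \<le> 1" "0 < l" "\<psi>' s > 0" "\<psi> s \<le> \<psi> t"
  shows "psi_kernel \<psi> \<psi>' \<alpha> t s * exp (l * (\<psi> s - c))
    \<le> exp (l * (\<psi> t - c)) * l powr (- (\<alpha> / 2)) * psi_kernel \<psi> \<psi>' (\<alpha> / 2) t s"
proof (cases "\<psi> s = \<psi> t")
  \<comment> \<open>Both kernels vanish here, by the convention \<open>0 powr b = 0\<close>.\<close>
  case True
  then show ?thesis by (simp add: psi_kernel_def)
next
  case False
  define d where "d = \<psi> t - \<psi> s"
  have d: "d > 0" using False assms by (simp add: d_def)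
  have e: "exp (l * (\<psi> s - c)) = exp (l * (\<psi> t - c)) * exp (- (l * d))"
    by (simp add: d_def flip: exp_add) (simp add: algebra_simps)
  have "exp (- (l * d)) * (l * d) powr (\<alpha> / 2) \<le> 1"
    using d assms by (intro exp_minus_mult_powr_le_1) auto
  then have "exp (- (l * d)) \<le> l powr (- (\<alpha> / 2)) * d powr (- (\<alpha> / 2))"
    using d assms(3) by (simp add: powr_mult powr_minus field_simps)
  then have "d powr (\<alpha> - 1) * exp (- (l * d))
      \<le> d powr (\<alpha> - 1) * (l powr (- (\<alpha> / 2)) * d powr (- (\<alpha> / 2)))"
    by (rule mult_left_mono) simp
  also have "\<dots> = l powr (- (\<alpha> / 2)) * d powr (\<alpha> / 2 - 1)"
    by (simp add: mult.left_commute flip: powr_add)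
  finally have "(exp (l * (\<psi> t - c)) * \<psi>' s) * (d powr (\<alpha> - 1) * exp (- (l * d)))
      \<le> (exp (l * (\<psi> t - c)) * \<psi>' s) * (l powr (- (\<alpha> / 2)) * d powr (\<alpha> / 2 - 1))"
    by (rule mult_left_mono) (use assms in simp)
  then show ?thesis
    unfolding psi_kernel_def e by (simp add: mult_ac flip: d_def)
qed

lemma continuous_kernel_section:
  assumes "continuous_kernel a k" and "a \<le> t" and "continuous_on {a..} z"
  shows "continuous_on {a..t} (\<lambda>s. k t s (z s))"
proof -
  have "continuous_on {a..t} (\<lambda>s. (t, s, z s))"
    by (intro continuous_intros continuous_on_subset[OF assms(3)]) auto
  moreover have "(\<lambda>s. (t, s, z s)) ` {a..t} \<subseteq> {(t, \<sigma>, u). (t, \<sigma>) \<in> tri_domain a}"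
    by (auto simp: tri_domain_def)
  ultimately show ?thesis
    using continuous_on_compose2[OF assms(1)[unfolded continuous_kernel_def]] by fastforce
qed

text \<open>The bound \<open>M\<close> relative to the weight is reproduced at \<open>t\<close>,
  multiplied by a factor that depends on \<open>l\<close> only through
  \<open>l powr (- (\<alpha> / 2))\<close> and so becomes small for large \<open>l\<close>.\<close>

lemma frac_integral_diff_le:
  fixes \<psi> :: "real \<Rightarrow> real" and k :: "real \<Rightarrow> real \<Rightarrow> real ^ 'n \<Rightarrow> real ^ 'n"
  assumes \<alpha>: "0 < \<alpha>" "\<alpha> \<le> 1" and p: "is_norm p"
    and der: "\<And>t. t \<ge> a \<Longrightarrow> (\<psi> has_real_derivative \<psi>' t) (at t within {a..})"
    and pos: "\<And>t. t \<ge> a \<Longrightarrow> \<psi>' t > 0"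
    and k: "continuous_kernel a k"
    and x: "continuous_on {a..} x" and y: "continuous_on {a..} y"
    and t: "a \<le> t" and l: "0 < l" and R: "0 \<le> R"
    and lip: "\<And>s u v. a \<le> s \<Longrightarrow> s \<le> t \<Longrightarrow> p (k t s u - k t s v) \<le> R * p (u - v)"
    and M: "\<And>s. a \<le> s \<Longrightarrow> s \<le> t \<Longrightarrow> p (x s - y s) \<le> M * exp (l * (\<psi> s - \<psi> a))"
  shows "p (frac_integral a \<psi> \<psi>' \<alpha> k x t - frac_integral a \<psi> \<psi>' \<alpha> k y t)
    \<le> R * (2 / \<alpha>) * (\<psi> t - \<psi> a) powr (\<alpha> / 2) / Gamma \<alpha> * l powr (- (\<alpha> / 2))
        * (M * exp (l * (\<psi> t - \<psi> a)))"
proof -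
  let ?K = "psi_kernel \<psi> \<psi>'"
  let ?E = "\<lambda>s. exp (l * (\<psi> s - \<psi> a))"
  let ?F = "\<lambda>z s. ?K \<alpha> t s *\<^sub>R k t s (z s)"
  have le: "\<psi> s \<le> \<psi> t" if "a \<le> s" "s \<le> t" for s
    using psi_strict_mono[OF der pos, of s t] that by (cases "s = t") auto
  have M0: "0 \<le> M"
  proof -
    have "0 \<le> p (x t - y t)" using p by (simp add: is_norm_def)
    also have "\<dots> \<le> M * ?E t" using M t by simp
    finally show ?thesis by (simp add: zero_le_mult_iff)
  qed
  \<comment> \<open>\<open>Q\<close> collects what does not depend on the integration
    variable.\<close>
  define Q where "Q = R * M * ?E t * l powr (- (\<alpha> / 2))"
  have int: "?F z integrable_on {a..t}" if "continuous_on {a..} z" for z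
    by (rule psi_kernel_integrable_scaleR[OF der pos \<alpha>(1) t continuous_kernel_section[OF k t that]])
  have "p (integral {a..t} (?F x) - integral {a..t} (?F y))
      \<le> Q * ((\<psi> t - \<psi> a) powr (\<alpha> / 2) / (\<alpha> / 2))"
  proof (rule is_norm_integral_le[OF p])
    show "((\<lambda>s. ?F x s - ?F y s) has_integral
        integral {a..t} (?F x) - integral {a..t} (?F y)) (cbox a t)"
      using int[OF x] int[OF y] by (simp add: has_integral_diff integrable_integral)
    show "((\<lambda>s. Q * ?K (\<alpha> / 2) t s) has_integral
        Q * ((\<psi> t - \<psi> a) powr (\<alpha> / 2) / (\<alpha> / 2))) (cbox a t)"
      using psi_kernel_has_integral[OF der pos _ t, of "\<alpha> / 2"] \<alpha>
      by (simp only: cbox_interval) (intro has_integral_mult_right, simp)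
    fix s assume "s \<in> cbox a t"
    then have s: "a \<le> s" "s \<le> t" by auto
    have K0: "0 \<le> ?K \<alpha> t s" using psi_kernel_nonneg pos s by blast
    have "p (?F x s - ?F y s) = ?K \<alpha> t s * p (k t s (x s) - k t s (y s))"
      using p K0 by (simp add: is_norm_def flip: scaleR_diff_right)
    also have "\<dots> \<le> ?K \<alpha> t s * (R * (M * ?E s))"
      using lip[OF s, of "x s" "y s"] mult_left_mono[OF M[OF s] R]
      by (intro mult_left_mono[OF _ K0]) linarith
    also have "\<dots> = R * M * (?K \<alpha> t s * ?E s)" by (simp add: mult_ac)
    also have "\<dots> \<le> R * M * (?E t * l powr (- (\<alpha> / 2)) * ?K (\<alpha> / 2) t s)"
      using psi_kernel_exp_weight_le[where \<psi>' = \<psi>' and s = s and t = t, OF \<alpha> l pos[OF s(1)] le[OF s]] R M0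
      by (intro mult_left_mono) auto
    finally show "p (?F x s - ?F y s) \<le> Q * ?K (\<alpha> / 2) t s"
      by (simp add: Q_def mult_ac)
  qed
  then have "1 / Gamma \<alpha> * p (integral {a..t} (?F x) - integral {a..t} (?F y))
      \<le> 1 / Gamma \<alpha> * (Q * ((\<psi> t - \<psi> a) powr (\<alpha> / 2) / (\<alpha> / 2)))"
    using Gamma_real_pos[OF \<alpha>(1)] by (intro mult_left_mono) auto
  moreover have "p (frac_integral a \<psi> \<psi>' \<alpha> k x t - frac_integral a \<psi> \<psi>' \<alpha> k y t)
      = 1 / Gamma \<alpha> * p (integral {a..t} (?F x) - integral {a..t} (?F y))"
    using p Gamma_real_pos[OF \<alpha>(1)]
    by (simp add: frac_integral_def is_norm_def flip: scaleR_diff_right)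
  ultimately have "p (frac_integral a \<psi> \<psi>' \<alpha> k x t - frac_integral a \<psi> \<psi>' \<alpha> k y t)
      \<le> 1 / Gamma \<alpha> * (Q * ((\<psi> t - \<psi> a) powr (\<alpha> / 2) / (\<alpha> / 2)))"
    by (simp only:)
  then show ?thesis by (simp add: Q_def mult_ac)
qed

text \<open>The triangle itself is unbounded, but its part with \<open>t \<le> T\<close> is
  compact.\<close>

lemma tri_domain_bounded:
  assumes "continuous_on (tri_domain a) (\<lambda>(t, \<sigma>). r t \<sigma> :: real)"
  obtains R where "0 \<le> R" "\<And>t \<sigma>. a \<le> \<sigma> \<Longrightarrow> \<sigma> \<le> t \<Longrightarrow> t \<le> T \<Longrightarrow> r t \<sigma> \<le> R"
proof -
  let ?S = "{a..T} \<times> {a..T} \<inter> {z. snd z \<le> fst z}"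
  have "compact ?S"
    by (intro compact_Int_closed compact_Times closed_Collect_le continuous_intros) auto
  moreover have "?S \<subseteq> tri_domain a" by (auto simp: tri_domain_def)
  ultimately have "bounded ((\<lambda>(t, \<sigma>). r t \<sigma>) ` ?S)"
    using assms by (intro compact_imp_bounded compact_continuous_image)
      (auto intro: continuous_on_subset)
  then obtain R where R: "\<And>w. w \<in> ?S \<Longrightarrow> norm ((\<lambda>(t, \<sigma>). r t \<sigma>) w) \<le> R"
    unfolding bounded_iff by blast
  show ?thesis
  \<comment> \<open>For \<open>T < a\<close> the set \<open>?S\<close> is empty and the bound
    \<open>R\<close> may be negative, hence the maximum with \<open>0\<close>.\<close>
  proof (rule that[of "max 0 R"])
    fix t \<sigma> assume "a \<le> \<sigma>" "\<sigma> \<le> t" "t \<le> T"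
    then show "r t \<sigma> \<le> max 0 R" using R[of "(t, \<sigma>)"] by auto
  qed simp
qed

section \<open>Continuous dependence on compact intervals\<close>

theorem theorem7:
  fixes a \<alpha> N :: real
    and \<psi> \<psi>' :: "real \<Rightarrow> real"
    and nrm :: "real ^ 'n \<Rightarrow> real"
    and f :: "real \<Rightarrow> real ^ 'n \<Rightarrow> real ^ 'n \<Rightarrow> real ^ 'n"
    and k :: "real \<Rightarrow> real \<Rightarrow> real ^ 'n \<Rightarrow> real ^ 'n"
    and r :: "real \<Rightarrow> real \<Rightarrow> real"
    and x :: "real \<Rightarrow> real ^ 'n"
  assumes "0 < \<alpha>" and "\<alpha> \<le> 1"
    and "is_norm nrm"
    and "mono_on {a..} \<psi>"
    and "\<And>t. t > a \<Longrightarrow> \<psi> t > 0"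
    and "\<And>t. t \<ge> a \<Longrightarrow> (\<psi> has_real_derivative \<psi>' t) (at t within {a..})"
    and "continuous_on {a..} \<psi>'"
    and "\<And>t. t \<ge> a \<Longrightarrow> \<psi>' t \<noteq> 0"
    and "continuous_rhs a f"
    and "continuous_kernel a k"
    and "0 \<le> N" and "N < 1"
    and "\<And>t u v u' v'. t \<ge> a \<Longrightarrow>
           nrm (f t u v - f t u' v') \<le> N * (nrm (u - u') + nrm (v - v'))"
    and "continuous_on (tri_domain a) (\<lambda>(t, \<sigma>). r t \<sigma>)"
    and "\<And>t \<sigma>. (t, \<sigma>) \<in> tri_domain a \<Longrightarrow> r t \<sigma> \<ge> 0"
    and "\<And>t \<sigma> u v. (t, \<sigma>) \<in> tri_domain a \<Longrightarrow>
           nrm (k t \<sigma> u - k t \<sigma> v) \<le> r t \<sigma> * nrm (u - v)"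
    and "is_solution a \<psi> \<psi>' \<alpha> f k x"
  shows "\<forall>T>a. \<forall>\<eta>>0. \<exists>\<epsilon>\<^sub>1>0. \<forall>f' k' y.
           continuous_rhs a f' \<and> continuous_kernel a k' \<and> is_solution a \<psi> \<psi>' \<alpha> f' k' y \<and>
           (\<forall>t\<in>{a..}. nrm (f t (y t) (frac_integral a \<psi> \<psi>' \<alpha> k y t)
                         - f' t (y t) (frac_integral a \<psi> \<psi>' \<alpha> k' y t)) \<le> \<epsilon>\<^sub>1)
           \<longrightarrow> (SUP t\<in>{a..T}. nrm (x t - y t)) \<le> \<eta>"
proof (intro allI impI)
  fix T \<eta> :: real assume T: "T > a" and \<eta>: "\<eta> > 0"
  note \<alpha> = assms(1,2) and p = assms(3) and der = assms(6) and N = assms(11,12)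
  have pos: "\<psi>' t > 0" if "t \<ge> a" for t
    using mono_on_derivative_nonneg[OF assms(4) that der[OF that]] assms(8)[OF that] by linarith
  have p0: "0 \<le> nrm u" and tri: "nrm (u + v) \<le> nrm u + nrm v" for u v
    using p by (auto simp: is_norm_def)
  have mono: "\<psi> s \<le> \<psi> t" if "a \<le> s" "s \<le> t" for s t
    using mono_onD[OF assms(4)] that by auto
  obtain R where R: "0 \<le> R" "\<And>t \<sigma>. a \<le> \<sigma> \<Longrightarrow> \<sigma> \<le> t \<Longrightarrow> t \<le> T \<Longrightarrow> r t \<sigma> \<le> R"
    using tri_domain_bounded[OF assms(14)] by blast
  \<comment> \<open>This is the factor of \<open>frac_integral_diff_le\<close> that does not involve
    \<open>l\<close>; \<open>c T\<close> bounds it on all of \<open>{a..T}\<close>.\<close>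
  define c where "c t = R * (2 / \<alpha>) * (\<psi> t - \<psi> a) powr (\<alpha> / 2) / Gamma \<alpha>" for t
  have c0: "0 \<le> c t" for t
    using R \<alpha> Gamma_real_pos[OF \<alpha>(1)] by (simp add: c_def)
  have cT: "c t \<le> c T" if "a \<le> t" "t \<le> T" for t
    unfolding c_def using R \<alpha> Gamma_real_pos[OF \<alpha>(1)] mono[of t T] mono[of a t] that
    by (intro divide_right_mono mult_left_mono powr_mono2) auto
  \<comment> \<open>\<open>q\<close> is the target value of
    \<open>l powr (- (\<alpha> / 2))\<close>. Adding \<open>1\<close> keeps the denominator positive
    when \<open>c T\<close> is zero.\<close>
  define q where "q = (1 - N) / (2 * (c T + 1))"
  have q: "0 < q" using N c0[of T] by (simp add: q_def)
  have cq: "c T * q \<le> (1 - N) / 2"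
    using N c0[of T] by (simp add: q_def field_simps)
  define l where "l = q powr (- (2 / \<alpha>))"
  have l: "0 < l" using q by (simp add: l_def)
  have lq: "l powr (- (\<alpha> / 2)) = q" using q \<alpha> by (simp add: l_def powr_powr)
  define E where "E t = exp (l * (\<psi> t - \<psi> a))" for t
  have E0: "0 < E t" for t by (simp add: E_def)
  have E1: "1 \<le> E t" if "a \<le> t" for t using mono[of a t] l that by (simp add: E_def)
  have ET: "E t \<le> E T" if "a \<le> t" "t \<le> T" for t using mono[of t T] l that by (simp add: E_def)
  \<comment> \<open>The final estimate loses a factor \<open>2 / (1 - N)\<close> by absorption and a
    factor \<open>E T\<close> by removing the weight. The choice is made before \<open>f'\<close>,
    \<open>k'\<close> and \<open>y\<close> are given.\<close>
  define \<epsilon> where "\<epsilon> = \<eta> * (1 - N) / (2 * E T)"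
  have \<epsilon>: "0 < \<epsilon>" using \<eta> N E0[of T] by (simp add: \<epsilon>_def)
  show "\<exists>\<epsilon>\<^sub>1>0. \<forall>f' k' y.
           continuous_rhs a f' \<and> continuous_kernel a k' \<and> is_solution a \<psi> \<psi>' \<alpha> f' k' y \<and>
           (\<forall>t\<in>{a..}. nrm (f t (y t) (frac_integral a \<psi> \<psi>' \<alpha> k y t)
                         - f' t (y t) (frac_integral a \<psi> \<psi>' \<alpha> k' y t)) \<le> \<epsilon>\<^sub>1)
           \<longrightarrow> (SUP t\<in>{a..T}. nrm (x t - y t)) \<le> \<eta>"
  proof (intro exI[of _ \<epsilon>] conjI \<epsilon> allI impI, elim conjE)
    fix f' k' and y :: "real \<Rightarrow> real ^ 'n"
    assume sol: "is_solution a \<psi> \<psi>' \<alpha> f' k' y"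
      and close: "\<forall>t\<in>{a..}. nrm (f t (y t) (frac_integral a \<psi> \<psi>' \<alpha> k y t)
                         - f' t (y t) (frac_integral a \<psi> \<psi>' \<alpha> k' y t)) \<le> \<epsilon>"
    let ?Ix = "frac_integral a \<psi> \<psi>' \<alpha> k x" and ?Iy = "frac_integral a \<psi> \<psi>' \<alpha> k y"
    have x: "continuous_on {a..} x" and y: "continuous_on {a..} y"
      using sol assms(17) by (auto simp: is_solution_def)
    define w where "w t = nrm (x t - y t)" for t
    have "continuous_on {a..} \<psi>"
      using der by (metis DERIV_continuous atLeast_iff continuous_on_eq_continuous_within)
    moreover have "continuous_on {a..} w"
      unfolding w_def
      by (rule continuous_on_compose2[OF is_norm_continuous_on[OF p, of UNIV]])
        (use x y in \<open>auto intro!: continuous_intros\<close>)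
    ultimately have "continuous_on {a..} (\<lambda>t. w t / E t)"
      unfolding E_def by (intro continuous_intros) auto
    then have "continuous_on {a..T} (\<lambda>t. w t / E t)"
      by (rule continuous_on_subset) auto
    \<comment> \<open>The weighted supremum is attained, so an estimate at the single point
      \<open>t\<close> suffices.\<close>
    then obtain t where t: "a \<le> t" "t \<le> T" and max: "\<And>s. s \<in> {a..T} \<Longrightarrow> w s / E s \<le> w t / E t"
      using continuous_attains_sup[of "{a..T}" "\<lambda>t. w t / E t"] T by auto
    define M where "M = w t / E t"
    have wt: "w t = M * E t" using E0[of t] by (simp add: M_def)
    have M0: "0 \<le> M" using p0 E0[of t] by (simp add: M_def w_def)
    have wM: "w s \<le> M * E s" if "a \<le> s" "s \<le> T" for s
      using max[of s] that E0[of s] by (simp add: M_def field_simps)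
    have "nrm (?Ix t - ?Iy t) \<le> c t * q * (M * E t)"
      unfolding c_def E_def lq[symmetric]
    proof (rule frac_integral_diff_le[OF \<alpha> p der pos assms(10) x y t(1) l R(1)])
      fix s u v assume s: "a \<le> s" "s \<le> t"
      have "nrm (k t s u - k t s v) \<le> r t s * nrm (u - v)"
        using assms(16)[of t s] s by (simp add: tri_domain_def)
      also have "\<dots> \<le> R * nrm (u - v)"
        using R(2)[OF s t(2)] p0 by (rule mult_right_mono)
      finally show "nrm (k t s u - k t s v) \<le> R * nrm (u - v)" .
      show "nrm (x s - y s) \<le> M * exp (l * (\<psi> s - \<psi> a))"
        using wM[of s] s t by (simp add: w_def E_def)
    qed
    also have "\<dots> \<le> (1 - N) / 2 * w t"
      unfolding wt using M0 E0[of t] order_trans[OF mult_right_mono[OF cT[OF t]] cq] q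
      by (intro mult_right_mono) auto
    finally have I: "nrm (?Ix t - ?Iy t) \<le> (1 - N) / 2 * w t" .
    \<comment> \<open>Inserting the original right-hand side at \<open>y\<close> separates a
      Lipschitz difference from the perturbation controlled by \<open>close\<close>.\<close>
    have "x t - y t = (f t (x t) (?Ix t) - f t (y t) (?Iy t))
        + (f t (y t) (?Iy t) - f' t (y t) (frac_integral a \<psi> \<psi>' \<alpha> k' y t))"
      using sol assms(17) t by (auto simp: is_solution_def)
    then have "w t \<le> nrm (f t (x t) (?Ix t) - f t (y t) (?Iy t))
        + nrm (f t (y t) (?Iy t) - f' t (y t) (frac_integral a \<psi> \<psi>' \<alpha> k' y t))"
      unfolding w_def by (metis tri)
    also have "\<dots> \<le> N * (w t + nrm (?Ix t - ?Iy t)) + \<epsilon>"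
      unfolding w_def using assms(13)[OF t(1)] close t by (intro add_mono) auto
    \<comment> \<open>The factor \<open>N\<close> before the integral term is bounded by
      \<open>1\<close>. The terms in \<open>w t\<close> then have total coefficient
      \<open>(1 + N) / 2\<close>, and moving them to the left leaves
      \<open>(1 - N) / 2\<close>.\<close>
    also have "\<dots> \<le> N * w t + (1 - N) / 2 * w t + \<epsilon>"
      using mult_mono[OF less_imp_le[OF N(2)] I] N p0 by (simp add: distrib_left)
    finally have "w t * (1 - N) \<le> 2 * \<epsilon>" by (simp add: field_simps)
    also have "\<dots> = \<eta> / E T * (1 - N)" by (simp add: \<epsilon>_def)
    finally have "w t \<le> \<eta> / E T"
      by (rule mult_right_le_imp_le) (use N in simp)
    \<comment> \<open>The weight is at least \<open>1\<close>, so the bound at the maximum point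
      bounds \<open>M\<close>, and \<open>M * E T\<close> then bounds \<open>w\<close> on the whole
      interval.\<close>
    moreover have "M \<le> w t" unfolding wt using E1[OF t(1)] M0 by (simp add: mult_le_cancel_left1)
    ultimately have "M \<le> \<eta> / E T" by linarith
    then have MT: "M * E T \<le> \<eta>" using E0[of T] by (simp add: field_simps)
    show "(SUP t\<in>{a..T}. nrm (x t - y t)) \<le> \<eta>"
    proof (rule cSUP_least)
      fix s assume "s \<in> {a..T}"
      then show "nrm (x s - y s) \<le> \<eta>"
        using wM[of s] mult_left_mono[OF ET[of s] M0] MT by (simp add: w_def)
    qed (use T in auto)
  qed
qed

end
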